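(* Let $\delta\in[0,1)$, $\theta\in(0,1)$ and $f\in\mathcal{F}_\delta$. The efficient score function $\tilde l_{\theta,f}$ and the efficient information $\tilde I_{\theta,f}$ for estimating $\theta$ in model $\mathcal{P}_\delta$ are given by $$\tilde l_{\theta,f}(x)=\frac1\theta-\frac{1}{\theta(1-\theta\delta)}\mathbf{1}_{[0,1-\delta)}(x)\quad\text{and}\quad \tilde I_{\theta,f}=\frac{\delta}{\theta(1-\theta\delta)}.$$ In particular, when $\delta=0$ the efficient information is zero; in this case the functional $\psi(\mathbb{P}_{\theta,f})=\theta$ is not differentiable at $\mathbb{P}_{\theta,f}$ relative to the tangent set $\dot{\mathcal{P}}_0$. Moreover, when $\delta>0$, the efficient influence function $\tilde\psi_{\theta,f}$ relative to the tangent set $\dot{\mathcal{P}}_\delta$ is given by $$\tilde\psi_{\theta,f}(x)=\frac1\delta\mathbf{1}_{[1-\delta,1]}(x)-\theta .$$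
   Context: For $\delta\in[0,1)$, $\mathcal{F}_\delta$ is the set of continuous non-increasing probability densities $f:[0,1]\to\mathbb{R}^+$ (w.r.t. Lebesgue measure) that are positive on $[0,1-\delta)$ and vanish on $[1-\delta,1]$. $\mathbb{P}_{\theta,f}$ is the probability on $[0,1]$ with density $\theta+(1-\theta)f$, and $\mathcal{P}_\delta=\{\mathbb{P}_{\theta,f}:(\theta,f)\in(0,1)\times\mathcal{F}_\delta\}$. Fix $(\theta,f)$. The tangent set for the nuisance parameter $f$ is $${}_f\dot{\mathcal{P}}_\delta=\Big\{h=\frac{(1-\theta)fh_0}{\theta+(1-\theta)f}\ :\ h_0 \text{ continuous and non-increasing on }[0,1-\delta),\ \int fh_0=0\Big\},$$ where $fh_0$ (hence $h$) is set to $0$ on $[1-\delta,1]$, and only those $h$ belonging to $\mathbb{L}_2(\mathbb{P}_{\theta,f})$ are considered. (These are the score functions at $t=0$ of the paths $t\mapsto \mathbb{P}_{\theta,f_t}$ with $f_t=k(th_0)f/\int k(th_0)f$, $k(u)=2(1+e^{-2u})^{-1}$.) The ordinary score for $\theta$ is $\dot l_{\theta,f}(x)=\frac{\partial}{\partial\theta}\log[\theta+(1-\theta)f(x)]=\frac{1-f(x)}{\theta+(1-\theta)f(x)}$. The tangent set for $(\theta,f)$ is $\dot{\mathcal{P}}_\delta=\{\alpha\dot l_{\theta,f}+\beta h:(\alpha,\beta)\in\mathbb{R}^2,\ h\in{}_f\dot{\mathcal{P}}_\delta\}$. The efficient score function is $\tilde l_{\theta,f}=\dot l_{\theta,f}-\Pi_{\theta,f}\dot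 l_{\theta,f}$, where $\Pi_{\theta,f}$ is the orthogonal projection in $\mathbb{L}_2(\mathbb{P}_{\theta,f})$ onto the closure of the linear span of ${}_f\dot{\mathcal{P}}_\delta$; the efficient information is $\tilde I_{\theta,f}=\int\tilde l_{\theta,f}^2\,d\mathbb{P}_{\theta,f}$. Functions are understood as elements of $\mathbb{L}_2(\mathbb{P}_{\theta,f})$. The functional $\psi:\mathbb{P}_{\theta,f}\mapsto\theta$ is differentiable at $\mathbb{P}_{\theta,f}$ relative to $\dot{\mathcal{P}}_\delta$ if there is $\tilde\psi_{\theta,f}\in\mathbb{L}_2(\mathbb{P}_{\theta,f})$ such that $$a=\int\tilde\psi_{\theta,f}(x)\,[a\,\dot l_{\theta,f}(x)+h(x)]\,d\mathbb{P}_{\theta,f}(x)\qquad\text{for all }a\in\mathbb{R},\ h\in{}_f\dot{\mathcal{P}}_\delta .$$ In that case the efficient influence function is the unique such $\tilde\psi_{\theta,f}$ lying in the closed linear span of $\dot{\mathcal{P}}_\delta$ in $\mathbb{L}_2(\mathbb{P}_{\theta,f})$. *)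

theory Defs
  imports "HOL-Analysis.Analysis"
begin

section \<open>The space \<open>L\<^sub>2\<close> over a measure\<close>

text \<open>
  Elements of \<open>L\<^sub>2\<close> are represented by functions, not by equivalence classes. All sets that are
  closed in \<open>L\<^sub>2\<close> below are invariant under almost everywhere equality, and an element of \<open>L\<^sub>2\<close> is
  described by characterising all of its representatives.
\<close>

definition L2 :: "'a measure \<Rightarrow> ('a \<Rightarrow> real) set" where
  "L2 M = {g \<in> borel_measurable M. integrable M (\<lambda>x. (g x)\<^sup>2)}"

definition lin_span :: "('a \<Rightarrow> real) set \<Rightarrow> ('a \<Rightarrow> real) set" where
  "lin_span S = {(\<lambda>x. \<Sum>i<n. c i * h i x) | (n::nat) (c::nat \<Rightarrow> real) h. \<forall>i<n. h i \<in> S}"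

definition L2_closure :: "'a measure \<Rightarrow> ('a \<Rightarrow> real) set \<Rightarrow> ('a \<Rightarrow> real) set" where
  "L2_closure M S =
     {g \<in> L2 M. \<forall>\<epsilon>>0. \<exists>s \<in> S \<inter> L2 M. sqrt (\<integral>x. (g x - s x)\<^sup>2 \<partial>M) < \<epsilon>}"

definition is_orth_projection ::
    "'a measure \<Rightarrow> ('a \<Rightarrow> real) set \<Rightarrow> ('a \<Rightarrow> real) \<Rightarrow> ('a \<Rightarrow> real) \<Rightarrow> bool" where
  "is_orth_projection M V g p \<longleftrightarrow>
     g \<in> L2 M \<and> p \<in> V \<inter> L2 M \<and> (\<forall>v \<in> V. (\<integral>x. (g x - p x) * v x \<partial>M) = 0)"

section \<open>The model\<close>

text \<open>Functions on \<open>[0,1]\<close> are total functions on the reals whose values outside \<open>[0,1]\<close> are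
  irrelevant.\<close>

definition density_class :: "real \<Rightarrow> (real \<Rightarrow> real) set" where
  "density_class \<delta> =
     {f. continuous_on {0..1} f \<and> antimono_on {0..1} f \<and>
         (\<forall>x\<in>{0..1}. 0 \<le> f x) \<and> (LINT x:{0..1}|lborel. f x) = 1 \<and>
         (\<forall>x\<in>{0..<1 - \<delta>}. 0 < f x) \<and> (\<forall>x\<in>{1 - \<delta>..1}. f x = 0)}"

definition mix_density :: "real \<Rightarrow> (real \<Rightarrow> real) \<Rightarrow> real \<Rightarrow> real" where
  "mix_density \<theta> f x = \<theta> + (1 - \<theta>) * f x"

definition mix_measure :: "real \<Rightarrow> (real \<Rightarrow> real) \<Rightarrow> real measure" where
  "mix_measure \<theta> f =
     density (restrict_space lborel {0..1}) (\<lambda>x. ennreal (mix_density \<theta> f x))"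

section \<open>Scores and tangent sets\<close>

definition score :: "real \<Rightarrow> (real \<Rightarrow> real) \<Rightarrow> real \<Rightarrow> real" where
  "score \<theta> f x = deriv (\<lambda>t. ln (mix_density t f x)) \<theta>"

lemma score_eq:
  assumes "0 < \<theta>" "\<theta> < 1" "0 \<le> f x"
  shows "score \<theta> f x = (1 - f x) / (\<theta> + (1 - \<theta>) * f x)"
proof -
  have pos: "0 < \<theta> + (1 - \<theta>) * f x"
    using assms by (intro add_pos_nonneg mult_nonneg_nonneg) auto
  have "((\<lambda>t. ln (t + (1 - t) * f x)) has_real_derivative
          (1 - f x) / (\<theta> + (1 - \<theta>) * f x)) (at \<theta>)"
    using pos by (auto intro!: derivative_eq_intros)
  then show ?thesis
    unfolding score_def mix_density_def by (rule DERIV_imp_deriv)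
qed

definition nuisance_score :: "real \<Rightarrow> real \<Rightarrow> (real \<Rightarrow> real) \<Rightarrow> (real \<Rightarrow> real) \<Rightarrow> real \<Rightarrow> real" where
  "nuisance_score \<delta> \<theta> f h0 x =
     (if x \<in> {0..<1 - \<delta>} then (1 - \<theta>) * f x * h0 x / mix_density \<theta> f x else 0)"

text \<open>Integrability of \<open>f h\<^sub>0\<close> is explicit because the integral of a non-integrable function is \<open>0\<close>
  by convention.\<close>

definition nuisance_tangent_set :: "real \<Rightarrow> real \<Rightarrow> (real \<Rightarrow> real) \<Rightarrow> (real \<Rightarrow> real) set" where
  "nuisance_tangent_set \<delta> \<theta> f =
     {nuisance_score \<delta> \<theta> f h0 | h0.
        continuous_on {0..<1 - \<delta>} h0 \<and> antimono_on {0..<1 - \<delta>} h0 \<and>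
        set_integrable lborel {0..<1 - \<delta>} (\<lambda>x. f x * h0 x) \<and>
        (LINT x:{0..<1 - \<delta>}|lborel. f x * h0 x) = 0}
     \<inter> L2 (mix_measure \<theta> f)"

definition tangent_set :: "real \<Rightarrow> real \<Rightarrow> (real \<Rightarrow> real) \<Rightarrow> (real \<Rightarrow> real) set" where
  "tangent_set \<delta> \<theta> f =
     {(\<lambda>x. \<alpha> * score \<theta> f x + \<beta> * h x) | \<alpha> \<beta> h. h \<in> nuisance_tangent_set \<delta> \<theta> f}"

section \<open>Efficient score, information and influence function\<close>

definition is_efficient_score :: "real \<Rightarrow> real \<Rightarrow> (real \<Rightarrow> real) \<Rightarrow> (real \<Rightarrow> real) \<Rightarrow> bool" where
  "is_efficient_score \<delta> \<theta> f l \<longleftrightarrow>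
     l \<in> L2 (mix_measure \<theta> f) \<and>
     (\<exists>p. is_orth_projection (mix_measure \<theta> f)
            (L2_closure (mix_measure \<theta> f) (lin_span (nuisance_tangent_set \<delta> \<theta> f)))
            (score \<theta> f) p \<and>
          (AE x in mix_measure \<theta> f. l x = score \<theta> f x - p x))"

text \<open>The choice of the representative is immaterial, since any two efficient scores agree almost
  everywhere.\<close>

definition efficient_information :: "real \<Rightarrow> real \<Rightarrow> (real \<Rightarrow> real) \<Rightarrow> real" where
  "efficient_information \<delta> \<theta> f =
     (\<integral>x. ((SOME l. is_efficient_score \<delta> \<theta> f l) x)\<^sup>2 \<partial>mix_measure \<theta> f)"

text \<open>Along a submodel with score \<open>a \<cdot> score + h\<close> the functional \<open>P\<^bsub>\<theta>,f\<^esub> \<mapsto> \<theta>\<close> has derivative \<open>a\<close>.\<close>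

definition is_influence_function :: "real \<Rightarrow> real \<Rightarrow> (real \<Rightarrow> real) \<Rightarrow> (real \<Rightarrow> real) \<Rightarrow> bool" where
  "is_influence_function \<delta> \<theta> f \<psi> \<longleftrightarrow>
     \<psi> \<in> L2 (mix_measure \<theta> f) \<and>
     (\<forall>a. \<forall>h \<in> nuisance_tangent_set \<delta> \<theta> f.
        a = (\<integral>x. \<psi> x * (a * score \<theta> f x + h x) \<partial>mix_measure \<theta> f))"

definition functional_differentiable :: "real \<Rightarrow> real \<Rightarrow> (real \<Rightarrow> real) \<Rightarrow> bool" where
  "functional_differentiable \<delta> \<theta> f \<longleftrightarrow> (\<exists>\<psi>. is_influence_function \<delta> \<theta> f \<psi>)"

definition is_efficient_influence_function ::
    "real \<Rightarrow> real \<Rightarrow> (real \<Rightarrow> real) \<Rightarrow> (real \<Rightarrow> real) \<Rightarrow> bool" where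
  "is_efficient_influence_function \<delta> \<theta> f \<psi> \<longleftrightarrow>
     is_influence_function \<delta> \<theta> f \<psi> \<and>
     \<psi> \<in> L2_closure (mix_measure \<theta> f) (lin_span (tangent_set \<delta> \<theta> f))"

end

theory Submission
  imports Defs
begin

text \<open>
  Let \<open>p\<close> be the score for \<open>\<theta>\<close> minus the claimed efficient score. It vanishes on \<open>[1 - \<delta>, 1]\<close>, and
  on \<open>[0, 1 - \<delta>)\<close> it is the nuisance score of a function of the form \<open>B / f - A\<close> with \<open>B > 0\<close>. That
  function is non-decreasing, so \<open>- p\<close> is itself a nuisance score and no closure is needed to see that
  \<open>p\<close> lies in the span. The claimed efficient score is constant on \<open>[0, 1 - \<delta>)\<close>, where all nuisance
  scores live and have mean zero, so it is orthogonal to them; hence \<open>p\<close> is the projection. For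
  \<open>\<delta> = 0\<close> the efficient score vanishes, the score for \<open>\<theta>\<close> plus the nuisance score \<open>- p\<close> is \<open>0\<close>, and
  an influence function would give \<open>1 = 0\<close>. For \<open>\<delta> > 0\<close> the efficient influence function is the
  efficient score divided by its squared norm.
\<close>

section \<open>Orthogonality in \<open>L\<^sub>2\<close>\<close>

text \<open>Expand the square of e|a| - |b| and divide by e. The case e = 1 makes products of
  \<open>L2\<close> functions integrable; small e does the work of Cauchy-Schwarz in the passage to
  closures.\<close>

lemma abs_mult_le_weighted_squares:
  fixes a b e :: real
  assumes "e > 0"
  shows "\<bar>a * b\<bar> \<le> e * a\<^sup>2 + b\<^sup>2 / e"
proof -
  have "2 * (e * \<bar>a\<bar>) * \<bar>b\<bar> \<le> (e * \<bar>a\<bar>)\<^sup>2 + \<bar>b\<bar>\<^sup>2"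
    by (rule sum_squares_bound)
  moreover have "0 \<le> e * \<bar>a\<bar> * \<bar>b\<bar>" using assms by simp
  ultimately have "e * \<bar>a\<bar> * \<bar>b\<bar> \<le> (e * \<bar>a\<bar>)\<^sup>2 + \<bar>b\<bar>\<^sup>2"
    by linarith
  also have "\<dots> = e * (e * a\<^sup>2 + b\<^sup>2 / e)"
    using assms by (simp add: power_mult_distrib distrib_left power2_eq_square)
  finally have "e * \<bar>a * b\<bar> \<le> e * (e * a\<^sup>2 + b\<^sup>2 / e)"
    by (simp add: abs_mult mult.assoc)
  then show ?thesis using assms by simp
qed

lemma L2_measurable: "u \<in> L2 M \<Longrightarrow> u \<in> borel_measurable M"
  by (simp add: L2_def)

lemma L2_integrable_mult:
  assumes "u \<in> L2 M" "v \<in> L2 M"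
  shows "integrable M (\<lambda>x. u x * v x)"
proof (rule Bochner_Integration.integrable_bound)
  show "integrable M (\<lambda>x. (u x)\<^sup>2 + (v x)\<^sup>2)"
    using assms by (simp add: L2_def)
  show "(\<lambda>x. u x * v x) \<in> borel_measurable M"
    using assms[THEN L2_measurable] by simp
  show "AE x in M. norm (u x * v x) \<le> norm ((u x)\<^sup>2 + (v x)\<^sup>2)"
    using abs_mult_le_weighted_squares[of 1] by auto
qed

lemma L2_lincomb:
  assumes "u \<in> L2 M" "v \<in> L2 M"
  shows "(\<lambda>x. a * u x + b * v x) \<in> L2 M"
proof -
  have "integrable M (\<lambda>x. a\<^sup>2 * (u x)\<^sup>2 + 2 * a * b * (u x * v x) + b\<^sup>2 * (v x)\<^sup>2)"
    using assms L2_integrable_mult[OF assms] by (auto simp: L2_def)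
  moreover have "(\<lambda>x. a\<^sup>2 * (u x)\<^sup>2 + 2 * a * b * (u x * v x) + b\<^sup>2 * (v x)\<^sup>2) =
      (\<lambda>x. (a * u x + b * v x)\<^sup>2)"
    by (auto simp: power2_eq_square algebra_simps)
  ultimately show ?thesis
    using assms[THEN L2_measurable] by (simp add: L2_def)
qed

lemma L2_diff:
  assumes "u \<in> L2 M" "v \<in> L2 M"
  shows "(\<lambda>x. u x - v x) \<in> L2 M"
  using L2_lincomb[OF assms, of 1 "-1"] by simp

lemma L2_bounded:
  assumes "finite_measure M" "u \<in> borel_measurable M" "\<And>x. x \<in> space M \<Longrightarrow> \<bar>u x\<bar> \<le> B"
  shows "u \<in> L2 M"
proof -
  interpret finite_measure M by fact
  have "integrable M (\<lambda>x. (u x)\<^sup>2)"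
  proof (rule integrable_const_bound)
    show "AE x in M. norm ((u x)\<^sup>2) \<le> B\<^sup>2"
    proof (rule AE_I2)
      fix x assume "x \<in> space M"
      then have "\<bar>u x\<bar>\<^sup>2 \<le> B\<^sup>2" using assms(3) by (intro power_mono) auto
      then show "norm ((u x)\<^sup>2) \<le> B\<^sup>2" by simp
    qed
  qed (use assms in simp)
  then show ?thesis using assms by (simp add: L2_def)
qed

text \<open>Subtracting the two orthogonality relations shows that u - v has norm 0. Every almost
  everywhere uniqueness claim below ends with this.\<close>

lemma L2_AE_eqI:
  assumes "u \<in> L2 M" "v \<in> L2 M" "(\<integral>x. (u x - v x) * u x \<partial>M) = 0" "(\<integral>x. (u x - v x) * v x \<partial>M) = 0"
  shows "AE x in M. u x = v x"
proof -
  note d = L2_diff[OF assms(1,2)]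
  have "(\<integral>x. (u x - v x)\<^sup>2 \<partial>M) = (\<integral>x. (u x - v x) * u x - (u x - v x) * v x \<partial>M)"
    by (simp add: power2_eq_square algebra_simps)
  also have "\<dots> = 0"
    using assms L2_integrable_mult[OF d assms(1)] L2_integrable_mult[OF d assms(2)] by simp
  finally have "AE x in M. (u x - v x)\<^sup>2 = 0"
    using d by (subst (asm) integral_nonneg_eq_0_iff_AE) (auto simp: L2_def)
  then show ?thesis by eventually_elim simp
qed

lemma lin_span_L2:
  assumes "S \<subseteq> L2 M"
  shows "lin_span S \<subseteq> L2 M"
proof
  fix s assume "s \<in> lin_span S"
  then obtain n :: nat and c h where s: "s = (\<lambda>x. \<Sum>i<n. c i * h i x)" and h: "\<forall>i<n. h i \<in> S"
    unfolding lin_span_def by blast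
  from h have "(\<lambda>x. \<Sum>i<n. c i * h i x) \<in> L2 M"
  proof (induction n)
    case 0
    then show ?case by (simp add: L2_def)
  next
    case (Suc n)
    then have "(\<lambda>x. 1 * (\<Sum>i<n. c i * h i x) + c n * h n x) \<in> L2 M"
      using assms by (intro L2_lincomb) auto
    then show ?case by simp
  qed
  then show "s \<in> L2 M" by (simp add: s)
qed

lemma lin_span_scale:
  assumes "s \<in> S"
  shows "(\<lambda>x. a * s x) \<in> lin_span S"
  unfolding lin_span_def
  by (rule CollectI, intro exI[of _ "1::nat"] exI[of _ "\<lambda>_. a"] exI[of _ "\<lambda>_. s"]) (use assms in simp)

text \<open>An element of S that agrees with g almost everywhere is at distance 0, so it serves for
  every \<epsilon> at once.\<close>

lemma L2_closureI:
  assumes "g \<in> L2 M" "s \<in> S" "s \<in> L2 M" "AE x in M. g x = s x"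
  shows "g \<in> L2_closure M S"
proof -
  have "(\<integral>x. (g x - s x)\<^sup>2 \<partial>M) = (\<integral>x. 0 \<partial>M)"
    using assms(4) assms(1,3)[THEN L2_measurable] by (intro integral_cong_AE) auto
  then have "sqrt (\<integral>x. (g x - s x)\<^sup>2 \<partial>M) = 0" by simp
  then show ?thesis
    using assms unfolding L2_closure_def by (auto intro!: bexI[of _ s])
qed

lemma orthogonal_lin_span:
  assumes "u \<in> L2 M" "S \<subseteq> L2 M" "\<And>s. s \<in> S \<Longrightarrow> (\<integral>x. u x * s x \<partial>M) = 0" "v \<in> lin_span S"
  shows "(\<integral>x. u x * v x \<partial>M) = 0"
proof -
  from assms(4) obtain n :: nat and c h where v: "v = (\<lambda>x. \<Sum>i<n. c i * h i x)" and h: "\<forall>i<n. h i \<in> S"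
    unfolding lin_span_def by blast
  have int: "integrable M (\<lambda>x. u x * h i x)" if "i < n" for i
    using that h assms(1,2) by (intro L2_integrable_mult) auto
  have "(\<integral>x. u x * v x \<partial>M) = (\<integral>x. (\<Sum>i<n. c i * (u x * h i x)) \<partial>M)"
    by (simp add: v sum_distrib_left mult.left_commute)
  also have "\<dots> = (\<Sum>i<n. c i * (\<integral>x. u x * h i x \<partial>M))"
    using int by (subst Bochner_Integration.integral_sum) auto
  also have "\<dots> = 0"
    using h assms(3) by (intro sum.neutral) auto
  finally show ?thesis .
qed

text \<open>For s in S within e of v, the integral of u v equals that of u (v - s), which the
  weighted inequality bounds by e times a constant independent of e.\<close>

lemma orthogonal_L2_closure:
  assumes u: "u \<in> L2 M" and orth: "\<And>s. s \<in> S \<Longrightarrow> s \<in> L2 M \<Longrightarrow> (\<integral>x. u x * s x \<partial>M) = 0"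
    and v: "v \<in> L2_closure M S"
  shows "(\<integral>x. u x * v x \<partial>M) = 0"
proof -
  let ?U = "\<integral>x. (u x)\<^sup>2 \<partial>M"
  have U: "0 \<le> ?U" by simp
  have vL: "v \<in> L2 M" using v by (simp add: L2_closure_def)
  have bound: "\<bar>\<integral>x. u x * v x \<partial>M\<bar> \<le> e * (?U + 1)" if e: "e > 0" for e
  proof -
    obtain s where s: "s \<in> S" "s \<in> L2 M" and less: "sqrt (\<integral>x. (v x - s x)\<^sup>2 \<partial>M) < e"
      using v e unfolding L2_closure_def by blast
    let ?D = "\<integral>x. (v x - s x)\<^sup>2 \<partial>M"
    have "sqrt ?D ^ 2 \<le> e ^ 2"
      using less by (intro power_mono) auto
    then have D: "?D \<le> e\<^sup>2" by simp
    note d = L2_diff[OF vL s(2)]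
    have i: "integrable M (\<lambda>x. (u x)\<^sup>2)" "integrable M (\<lambda>x. (v x - s x)\<^sup>2)"
      using u d by (auto simp: L2_def)
    have "(\<integral>x. u x * v x \<partial>M) = (\<integral>x. u x * (v x - s x) + u x * s x \<partial>M)"
      by (simp add: algebra_simps)
    also have "\<dots> = (\<integral>x. u x * (v x - s x) \<partial>M)"
      using L2_integrable_mult[OF u d] L2_integrable_mult[OF u s(2)] orth[OF s] by simp
    finally have "\<bar>\<integral>x. u x * v x \<partial>M\<bar> = \<bar>\<integral>x. u x * (v x - s x) \<partial>M\<bar>" by simp
    also have "\<dots> \<le> (\<integral>x. \<bar>u x * (v x - s x)\<bar> \<partial>M)"
      using integral_norm_bound[of M "\<lambda>x. u x * (v x - s x)"] by simp
    also have "\<dots> \<le> (\<integral>x. e * (u x)\<^sup>2 + (v x - s x)\<^sup>2 / e \<partial>M)"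
      using e i L2_integrable_mult[OF u d]
      by (intro integral_mono abs_mult_le_weighted_squares) auto
    also have "\<dots> = e * ?U + ?D / e"
      using i by simp
    also have "\<dots> \<le> e * ?U + e"
      using D e by (simp add: divide_le_eq power2_eq_square)
    finally show ?thesis by (simp add: algebra_simps)
  qed
  show ?thesis
  proof (rule ccontr)
    assume "(\<integral>x. u x * v x \<partial>M) \<noteq> 0"
    moreover define r where "r = \<bar>\<integral>x. u x * v x \<partial>M\<bar>"
    ultimately have r: "0 < r" by simp
    \<comment> \<open>This e turns the bound into r / 2, which is impossible for r > 0.\<close>
    then have "r \<le> r / (2 * (?U + 1)) * (?U + 1)"
      using bound[of "r / (2 * (?U + 1))"] U unfolding r_def by simp
    also have "\<dots> = r / 2"
    proof -
      have "?U + 1 \<noteq> 0" using U by linarith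
      then show ?thesis by (metis nonzero_mult_div_cancel_right times_divide_eq_left mult_divide_mult_cancel_right)
    qed
    finally show False using r by simp
  qed
qed

text \<open>Both residuals are orthogonal to V, hence so is their difference p - q; testing it
  against p and against q gives the claim.\<close>

lemma orth_projection_unique:
  assumes "is_orth_projection M V g p" "is_orth_projection M V g q"
  shows "AE x in M. p x = q x"
proof -
  have gL: "g \<in> L2 M" and pV: "p \<in> V" and pL: "p \<in> L2 M" and qV: "q \<in> V" and qL: "q \<in> L2 M"
    using assms by (auto simp: is_orth_projection_def)
  have "(\<integral>x. (p x - q x) * v x \<partial>M) = 0" if "v \<in> V" "v \<in> L2 M" for v
  proof -
    have "(\<integral>x. (p x - q x) * v x \<partial>M) = (\<integral>x. (g x - q x) * v x - (g x - p x) * v x \<partial>M)"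
      by (simp add: algebra_simps)
    also have "\<dots> = (\<integral>x. (g x - q x) * v x \<partial>M) - (\<integral>x. (g x - p x) * v x \<partial>M)"
      using that gL pL qL by (intro Bochner_Integration.integral_diff L2_integrable_mult L2_diff)
    also have "\<dots> = 0"
      using assms that by (simp add: is_orth_projection_def)
    finally show ?thesis .
  qed
  then show ?thesis using pV pL qV qL by (intro L2_AE_eqI) auto
qed

section \<open>The model at a fixed parameter\<close>

locale mixture_model =
  fixes \<delta> \<theta> :: real and f :: "real \<Rightarrow> real"
  assumes \<delta>: "0 \<le> \<delta>" "\<delta> < 1" and \<theta>: "0 < \<theta>" "\<theta> < 1" and f: "f \<in> density_class \<delta>"
begin

abbreviation "M \<equiv> mix_measure \<theta> f"
abbreviation "g \<equiv> mix_density \<theta> f"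

text \<open>The candidate for the efficient score; \<open>is_efficient_score_iff\<close> confirms
  it.\<close>

definition eff_score :: "real \<Rightarrow> real" where
  "eff_score x = 1 / \<theta> - 1 / (\<theta> * (1 - \<theta> * \<delta>)) * indicat_real {0..<1 - \<delta>} x"

definition score_proj :: "real \<Rightarrow> real" where
  "score_proj x = score \<theta> f x - eff_score x"

lemma \<theta>\<delta>: "\<theta> * \<delta> < 1"
  using \<delta> \<theta> mult_strict_mono[of \<theta> 1 \<delta> 1] by simp

section \<open>The mixture density and reduction to Lebesgue integrals\<close>

lemma f_cont: "continuous_on {0..1} f" and f_antimono: "antimono_on {0..1} f"
  and f_nonneg: "x \<in> {0..1} \<Longrightarrow> 0 \<le> f x" and f_integral: "(LINT x:{0..1}|lborel. f x) = 1"
  and f_pos: "x \<in> {0..<1 - \<delta>} \<Longrightarrow> 0 < f x" and f_zero: "x \<in> {1 - \<delta>..1} \<Longrightarrow> f x = 0"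
  using f unfolding density_class_def by auto

lemma f_le: "x \<in> {0..1} \<Longrightarrow> f x \<le> f 0"
  using f_antimono by (auto simp: monotone_on_def)

lemma g_ge: "x \<in> {0..1} \<Longrightarrow> \<theta> \<le> g x"
  using f_nonneg \<theta> by (simp add: mix_density_def)

lemma g_pos: "x \<in> {0..1} \<Longrightarrow> 0 < g x"
  using g_ge \<theta> by fastforce

text \<open>Outside [0,1] the function f is arbitrary, so measurability can be claimed only on the
  restricted space.\<close>

lemma f_measurable: "f \<in> borel_measurable (restrict_space lborel {0..1})"
proof -
  have "f \<in> borel_measurable (restrict_space borel {0..1})"
    by (rule borel_measurable_continuous_on_restrict[OF f_cont])
  moreover have "sets (restrict_space lborel {0..1}) = sets (restrict_space borel {0..1::real})"
    by (rule sets_restrict_space_cong) simp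
  ultimately show ?thesis
    by (simp cong: measurable_cong_sets)
qed

lemma g_measurable: "g \<in> borel_measurable (restrict_space lborel {0..1})"
  unfolding mix_density_def[abs_def] using f_measurable by simp

lemma space_M: "space M = {0..1}"
  by (simp add: mix_measure_def space_restrict_space)

lemma sets_M: "sets M = sets (restrict_space lborel {0..1})"
  by (simp add: mix_measure_def)

lemma M_measurableI: "u \<in> borel_measurable lborel \<Longrightarrow> u \<in> borel_measurable M"
  unfolding measurable_cong_sets[OF sets_M refl] by (rule measurable_restrict_space1)

lemma f_M_measurable: "f \<in> borel_measurable M"
  unfolding measurable_cong_sets[OF sets_M refl] by (rule f_measurable)

text \<open>Measurability of u suffices: when u is not integrable, both sides have the default value
  0.\<close>

lemma integral_M:
  assumes "u \<in> borel_measurable M"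
  shows "(\<integral>x. u x \<partial>M) = (LINT x:{0..1}|lborel. g x * u x)"
proof -
  have u: "u \<in> borel_measurable (restrict_space lborel {0..1})"
    using assms by (simp add: measurable_cong_sets[OF sets_M refl])
  have "(\<integral>x. u x \<partial>M) = (\<integral>x. g x *\<^sub>R u x \<partial>restrict_space lborel {0..1})"
    unfolding mix_measure_def
    using g_pos by (intro integral_density u g_measurable AE_I2) (auto simp: space_restrict_space intro: less_imp_le)
  then show ?thesis
    by (simp add: integral_restrict_space set_lebesgue_integral_def)
qed

lemma f_set_integrable: "set_integrable lborel {0..1} f"
  using borel_integrable_compact[OF compact_Icc f_cont]
  by (simp add: set_integrable_def)

lemma f_set_integrable': "set_integrable lborel {0..<1 - \<delta>} f"
  using \<delta> by (intro set_integrable_subset[OF f_set_integrable]) auto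

lemma f_integral': "(LINT x:{0..<1 - \<delta>}|lborel. f x) = 1"
proof -
  have "(LINT x:{0..<1 - \<delta>}|lborel. f x) = (LINT x:{0..1}|lborel. f x)"
    unfolding set_lebesgue_integral_def
    using f_zero \<delta> by (intro Bochner_Integration.integral_cong) (auto simp: indicator_def)
  then show ?thesis using f_integral by simp
qed

text \<open>Finiteness puts bounded measurable functions into \<open>L2 M\<close>; it follows from
  integrability of g on [0,1].\<close>

sublocale finite_measure M
proof
  have g: "set_integrable lborel {0..1} g"
    unfolding mix_density_def[abs_def] using f_set_integrable
    by (intro set_integral_add(1) set_integrable_mult_right) (auto simp: set_integrable_def)
  have "emeasure M (space M) = (\<integral>\<^sup>+x. ennreal (g x) \<partial>restrict_space lborel {0..1})"
    unfolding mix_measure_def using g_measurable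
    by (subst emeasure_density) (auto simp: space_restrict_space sets_restrict_space_iff indicator_def intro!: nn_integral_cong)
  also have "\<dots> = (\<integral>\<^sup>+x. ennreal (indicator {0..1} x *\<^sub>R g x) \<partial>lborel)"
    by (subst nn_integral_restrict_space) (auto simp: indicator_def intro!: nn_integral_cong)
  also have "\<dots> < \<infinity>"
    using g g_pos unfolding set_integrable_def
    by (subst nn_integral_eq_integral) (auto simp: indicator_def intro!: AE_I2 less_imp_le)
  finally show "emeasure M (space M) \<noteq> \<infinity>" by simp
qed

section \<open>Square integrability of the scores\<close>

lemma score_unit:
  assumes "x \<in> {0..1}"
  shows "score \<theta> f x = (1 - f x) / g x"
  using score_eq[where f = f and x = x, OF \<theta> f_nonneg[OF assms]] by (simp add: mix_density_def)

text \<open>The score is bounded: monotonicity gives f \<le> f 0 in the numerator, and the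
  denominator is at least \<theta>.\<close>

lemma score_L2: "score \<theta> f \<in> L2 M"
proof (rule L2_bounded[OF finite_measure_axioms])
  have "(\<lambda>x. (1 - f x) / g x) \<in> borel_measurable M"
    unfolding mix_density_def using f_M_measurable by simp
  then show "score \<theta> f \<in> borel_measurable M"
    using score_unit space_M by (subst measurable_cong) auto
next
  fix x assume "x \<in> space M"
  then have x: "x \<in> {0..1}" using space_M by simp
  have "\<bar>score \<theta> f x\<bar> = \<bar>1 - f x\<bar> / g x"
    using g_pos[OF x] by (simp add: score_unit[OF x])
  also have "\<dots> \<le> (1 + f 0) / \<theta>"
    using g_ge[OF x] \<theta> f_le[OF x] f_nonneg[OF x] by (intro frac_le) auto
  finally show "\<bar>score \<theta> f x\<bar> \<le> (1 + f 0) / \<theta>" .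
qed

lemma eff_score_L2: "eff_score \<in> L2 M"
proof (rule L2_bounded[OF finite_measure_axioms])
  show "eff_score \<in> borel_measurable M"
    unfolding eff_score_def[abs_def] by (intro M_measurableI) simp
  show "\<bar>eff_score x\<bar> \<le> \<bar>1 / \<theta>\<bar> + \<bar>1 / (\<theta> * (1 - \<theta> * \<delta>))\<bar>" for x
    using abs_triangle_ineq4[of "1 / \<theta>" "1 / (\<theta> * (1 - \<theta> * \<delta>))"]
    unfolding eff_score_def by (auto simp: indicator_def)
qed

lemma score_proj_L2: "score_proj \<in> L2 M"
  unfolding score_proj_def[abs_def] by (intro L2_diff score_L2 eff_score_L2)

section \<open>The nuisance tangent set and the projection of the score\<close>

abbreviation "T \<equiv> nuisance_tangent_set \<delta> \<theta> f"

lemma nuisance_L2: "T \<subseteq> L2 M"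
  unfolding nuisance_tangent_set_def by auto

lemma tangent_L2: "tangent_set \<delta> \<theta> f \<subseteq> L2 M"
  unfolding tangent_set_def using nuisance_L2 by (auto intro!: L2_lincomb score_L2)

text \<open>Lets an influence function be tested against the score for \<theta> alone.\<close>

lemma zero_nuisance: "(\<lambda>x. 0) \<in> T"
proof -
  have "(\<lambda>x. 0) = nuisance_score \<delta> \<theta> f (\<lambda>x. 0)"
    by (auto simp: nuisance_score_def)
  then show ?thesis
    unfolding nuisance_tangent_set_def
    by (auto simp: L2_def monotone_on_def set_integrable_def set_lebesgue_integral_def intro!: exI[of _ "\<lambda>x. 0"])
qed

lemma neg_score_proj_nuisance:
  obtains h where "h \<in> T" "AE x in M. h x = - score_proj x"
proof
  \<comment> \<open>Solving (1 - \<theta>) f h0 / g = - \<open>score_proj\<close> for h0 on [0, 1 -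
    \<delta>) gives A - B / f. Here A simplifies to B (1 - \<delta>), so h0 is a positive multiple
    of 1 - u / f with u the uniform density on [0, 1 - \<delta>).\<close>
  define A where "A = (1 / \<theta> - (1 - \<theta>) / (\<theta> * (1 - \<theta> * \<delta>))) / (1 - \<theta>)"
  define B where "B = 1 / ((1 - \<theta>) * (1 - \<theta> * \<delta>))"
  define h0 where "h0 x = A - B / f x" for x
  have B: "B > 0" using \<theta> \<theta>\<delta> by (simp add: B_def)
  let ?h = "nuisance_score \<delta> \<theta> f h0"
  have sub: "{0..<1 - \<delta>} \<subseteq> {0..1}" using \<delta> by auto
  have eq: "?h x = - score_proj x" if "x \<in> {0..1}" for x
  proof (cases "x < 1 - \<delta>")
    case True
    then have x: "x \<in> {0..<1 - \<delta>}" using that by auto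
    have "0 < \<theta> + (1 - \<theta>) * f x" "0 < f x" "1 - \<theta> \<noteq> 0" "1 - \<theta> * \<delta> \<noteq> 0" "\<theta> \<noteq> 0"
      using g_pos[OF that] f_pos[OF x] \<theta> \<theta>\<delta> by (auto simp: mix_density_def)
    moreover define a b q where "a = f x" and "b = 1 - \<theta> * \<delta>" and q: "q = \<theta> + (1 - \<theta>) * a"
    ultimately have nz: "q \<noteq> 0" "a \<noteq> 0" "1 - \<theta> \<noteq> 0" "b \<noteq> 0" "\<theta> \<noteq> 0" by auto
    have fh: "(1 - \<theta>) * a * (A - B / a) = a * (1 / \<theta> - (1 - \<theta>) / (\<theta> * b)) - 1 / b"
    proof -
      have "(1 - \<theta>) * a * (A - B / a) = a * ((1 - \<theta>) * A) - (1 - \<theta>) * B"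
        using nz by (simp add: right_diff_distrib)
      then show ?thesis using nz by (simp add: A_def B_def b_def[symmetric])
    qed
    \<comment> \<open>With q the mixture density at x, this and the next equality rest on q =
      \<theta> + (1 - \<theta>) a and its rearrangement a = q - \<theta> (1 - a).\<close>
    have "a * (1 / \<theta> - (1 - \<theta>) / (\<theta> * b)) - 1 / b = (a * b - q) / (\<theta> * b)"
      using nz by (simp add: divide_simps) (simp add: q algebra_simps)
    also have "\<dots> = q * (1 / \<theta> - 1 / (\<theta> * b)) - (1 - a)"
      using nz by (simp add: divide_simps) (simp add: q algebra_simps)
    finally have "(1 - \<theta>) * a * (A - B / a) / q = - ((1 - a) / q - (1 / \<theta> - 1 / (\<theta> * b)))"
      unfolding fh using nz by (simp add: diff_divide_distrib)
    then show ?thesis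
      using x by (simp add: nuisance_score_def h0_def score_proj_def eff_score_def score_unit[OF that]
          mix_density_def a_def b_def q)
  next
    case False
    \<comment> \<open>So \<open>score\<close> and \<open>eff_score\<close> both equal 1 / \<theta>
      here, and \<open>score_proj\<close> vanishes.\<close>
    then have "f x = 0" using that by (intro f_zero) auto
    then show ?thesis
      using False by (simp add: nuisance_score_def score_proj_def eff_score_def score_unit[OF that] mix_density_def)
  qed
  \<comment> \<open>The factor 1 / f is unbounded near 1 - \<delta>, but it cancels in f h0 = A f -
    B, which makes integrability plain.\<close>
  have fh0: "indicator {0..<1 - \<delta>} x *\<^sub>R (f x * h0 x) =
      A * (indicator {0..<1 - \<delta>} x *\<^sub>R f x) - B * indicator {0..<1 - \<delta>} x" for x
    using f_pos[of x] by (auto simp: indicator_def h0_def field_simps)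
  have i: "integrable lborel (\<lambda>x. indicator {0..<1 - \<delta>} x *\<^sub>R f x)"
    "integrable lborel (indicat_real {0..<1 - \<delta>})"
    using f_set_integrable' \<delta> by (auto simp: set_integrable_def)
  have "continuous_on {0..<1 - \<delta>} h0"
    unfolding h0_def using continuous_on_subset[OF f_cont sub] f_pos
    by (intro continuous_intros) fastforce+
  moreover have "antimono_on {0..<1 - \<delta>} h0"
  proof (rule monotone_onI)
    fix x y :: real assume xy: "x \<in> {0..<1 - \<delta>}" "y \<in> {0..<1 - \<delta>}" "x \<le> y"
    then have "f y \<le> f x" using monotone_onD[OF f_antimono] subsetD[OF sub] by blast
    then have "B / f x \<le> B / f y" using B f_pos[OF xy(2)] by (intro divide_left_mono mult_pos_pos) auto
    then show "h0 y \<le> h0 x" by (simp add: h0_def)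
  qed
  moreover have "set_integrable lborel {0..<1 - \<delta>} (\<lambda>x. f x * h0 x)"
    unfolding set_integrable_def fh0 using i by auto
  moreover have "(LINT x:{0..<1 - \<delta>}|lborel. f x * h0 x) = 0"
  proof -
    have "(LINT x:{0..<1 - \<delta>}|lborel. f x * h0 x) = A * (LINT x:{0..<1 - \<delta>}|lborel. f x) - B * (1 - \<delta>)"
      unfolding set_lebesgue_integral_def fh0 using i \<delta> by simp
    also have "\<dots> = 0"
      using f_integral' \<theta> \<theta>\<delta> by (simp add: A_def B_def divide_simps) (simp add: algebra_simps)
    finally show ?thesis .
  qed
  moreover have "?h \<in> L2 M"
  proof -
    have "(\<lambda>x. - score_proj x) \<in> L2 M"
      using L2_lincomb[OF score_proj_L2 score_proj_L2, of "-1" 0] by simp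
    moreover have "?h \<in> borel_measurable M \<longleftrightarrow> (\<lambda>x. - score_proj x) \<in> borel_measurable M"
      using eq space_M by (intro measurable_cong) auto
    moreover have "integrable M (\<lambda>x. (?h x)\<^sup>2) \<longleftrightarrow> integrable M (\<lambda>x. (- score_proj x)\<^sup>2)"
      using eq space_M by (intro Bochner_Integration.integrable_cong) auto
    ultimately show ?thesis by (simp add: L2_def)
  qed
  ultimately show "?h \<in> T" unfolding nuisance_tangent_set_def by blast
  show "AE x in M. ?h x = - score_proj x" using eq space_M by (intro AE_I2) auto
qed

text \<open>The weight g cancels the denominator of h, and \<open>eff_score\<close> is constant
  where h lives, so only a multiple of the vanishing integral of f h0 remains.\<close>

lemma eff_score_orth_nuisance:
  assumes "h \<in> T"
  shows "(\<integral>x. eff_score x * h x \<partial>M) = 0"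
proof -
  obtain h0 where h: "h = nuisance_score \<delta> \<theta> f h0"
    and int: "(LINT x:{0..<1 - \<delta>}|lborel. f x * h0 x) = 0"
    using assms unfolding nuisance_tangent_set_def by blast
  have hM: "(\<lambda>x. eff_score x * h x) \<in> borel_measurable M"
    using assms nuisance_L2 eff_score_L2 by (intro borel_measurable_times L2_measurable) auto
  define K where "K = (1 / \<theta> - 1 / (\<theta> * (1 - \<theta> * \<delta>))) * (1 - \<theta>)"
  have eq: "indicator {0..1} x *\<^sub>R (g x * (eff_score x * h x)) =
      K * (indicator {0..<1 - \<delta>} x *\<^sub>R (f x * h0 x))" for x
    using g_pos[of x] \<delta> by (auto simp: h nuisance_score_def eff_score_def K_def indicator_def)
  have "(\<integral>x. eff_score x * h x \<partial>M) = K * (LINT x:{0..<1 - \<delta>}|lborel. f x * h0 x)"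
    unfolding integral_M[OF hM] unfolding set_lebesgue_integral_def eq by simp
  then show ?thesis using int by simp
qed

lemma eff_score_orth_closure:
  "v \<in> L2_closure M (lin_span T) \<Longrightarrow> (\<integral>x. eff_score x * v x \<partial>M) = 0"
  by (rule orthogonal_L2_closure[OF eff_score_L2])
    (rule orthogonal_lin_span[OF eff_score_L2 nuisance_L2 eff_score_orth_nuisance])

lemma score_proj_closure: "score_proj \<in> L2_closure M (lin_span T)"
proof -
  obtain h where h: "h \<in> T" "AE x in M. h x = - score_proj x"
    by (rule neg_score_proj_nuisance)
  \<comment> \<open>The sign is repaired by the span: \<open>T\<close> demands a non-increasing h0,
    but coefficients may be negative.\<close>
  have s: "(\<lambda>x. - 1 * h x) \<in> lin_span T" using h(1) by (rule lin_span_scale)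
  show ?thesis
  proof (rule L2_closureI[OF score_proj_L2 s])
    show "(\<lambda>x. - 1 * h x) \<in> L2 M" using s lin_span_L2[OF nuisance_L2] by blast
    show "AE x in M. score_proj x = - 1 * h x" using h(2) by eventually_elim simp
  qed
qed

text \<open>The residual is \<open>eff_score\<close> by definition, already known to be orthogonal
  to the closure.\<close>

lemma score_proj_is_orth_projection:
  "is_orth_projection M (L2_closure M (lin_span T)) (score \<theta> f) score_proj"
  unfolding is_orth_projection_def
  using score_L2 score_proj_L2 score_proj_closure eff_score_orth_closure
  by (simp add: score_proj_def)

lemma is_efficient_score_iff:
  "is_efficient_score \<delta> \<theta> f l \<longleftrightarrow> l \<in> L2 M \<and> (AE x in M. l x = eff_score x)"
proof safe
  assume l: "is_efficient_score \<delta> \<theta> f l"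
  then show "l \<in> L2 M" by (simp add: is_efficient_score_def)
  from l obtain p where p: "is_orth_projection M (L2_closure M (lin_span T)) (score \<theta> f) p"
    and lp: "AE x in M. l x = score \<theta> f x - p x"
    unfolding is_efficient_score_def by blast
  from orth_projection_unique[OF p score_proj_is_orth_projection] lp
  show "AE x in M. l x = eff_score x"
    by eventually_elim (simp add: score_proj_def)
next
  assume "l \<in> L2 M" "AE x in M. l x = eff_score x"
  then show "is_efficient_score \<delta> \<theta> f l"
    unfolding is_efficient_score_def using score_proj_is_orth_projection
    by (auto simp: score_proj_def intro!: exI[of _ score_proj])
qed

section \<open>The efficient information\<close>

lemma eff_score_square_integral: "(\<integral>x. (eff_score x)\<^sup>2 \<partial>M) = \<delta> / (\<theta> * (1 - \<theta> * \<delta>))"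
proof -
  define d where "d = 1 / \<theta> - 1 / (\<theta> * (1 - \<theta> * \<delta>))"
  define c where "c = d\<^sup>2"
  have val: "eff_score x = (if x \<in> {0..<1 - \<delta>} then d else 1 / \<theta>)" for x
    by (simp add: eff_score_def d_def)
  have m: "(\<lambda>x. (eff_score x)\<^sup>2) \<in> borel_measurable M"
    using L2_measurable[OF eff_score_L2] by simp
  have eq: "indicator {0..1} x *\<^sub>R (g x * (eff_score x)\<^sup>2) =
      c * \<theta> * indicator {0..<1 - \<delta>} x + c * (1 - \<theta>) * (indicator {0..<1 - \<delta>} x *\<^sub>R f x)
        + 1 / \<theta> * indicator {1 - \<delta>..1} x" for x
    using f_zero[of x] \<delta> \<theta>
    by (auto simp: mix_density_def val c_def indicator_def algebra_simps power2_eq_square)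
  have i: "integrable lborel (\<lambda>x. indicator {0..<1 - \<delta>} x *\<^sub>R f x)"
    "integrable lborel (indicat_real {0..<1 - \<delta>})" "integrable lborel (indicat_real {1 - \<delta>..1})"
    using f_set_integrable' \<delta> by (auto simp: set_integrable_def)
  \<comment> \<open>The two values d and 1 / \<theta> are taken with probabilities \<theta> (1 -
    \<delta>) + (1 - \<theta>) = 1 - \<theta>\<delta> and \<theta>\<delta>.\<close>
  have "(\<integral>x. (eff_score x)\<^sup>2 \<partial>M) =
      c * \<theta> * (1 - \<delta>) + c * (1 - \<theta>) * (LINT x:{0..<1 - \<delta>}|lborel. f x) + 1 / \<theta> * \<delta>"
    unfolding integral_M[OF m] unfolding set_lebesgue_integral_def eq using i \<delta> by simp
  also have "\<dots> = c * (1 - \<theta> * \<delta>) + \<delta> / \<theta>"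
    unfolding f_integral' by (simp add: algebra_simps)
  also have "c = (\<delta> / (1 - \<theta> * \<delta>))\<^sup>2"
  proof -
    have "d = - (\<delta> / (1 - \<theta> * \<delta>))"
      using \<theta> \<theta>\<delta> by (simp add: d_def divide_simps)
    then show ?thesis by (simp add: c_def)
  qed
  also have "(\<delta> / (1 - \<theta> * \<delta>))\<^sup>2 * (1 - \<theta> * \<delta>) + \<delta> / \<theta> = \<delta> / (\<theta> * (1 - \<theta> * \<delta>))"
    using \<theta> \<theta>\<delta> by (simp add: divide_simps power2_eq_square) (simp add: algebra_simps)
  finally show ?thesis .
qed

text \<open>Whichever representative \<open>SOME\<close> picks, it agrees with
  \<open>eff_score\<close> almost everywhere, so its squared integral is the same.\<close>

lemma efficient_information_eq: "efficient_information \<delta> \<theta> f = \<delta> / (\<theta> * (1 - \<theta> * \<delta>))"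
proof -
  define l where "l = (SOME l. is_efficient_score \<delta> \<theta> f l)"
  have "is_efficient_score \<delta> \<theta> f eff_score"
    using eff_score_L2 by (simp add: is_efficient_score_iff)
  then have "is_efficient_score \<delta> \<theta> f l"
    unfolding l_def by (rule someI[of "is_efficient_score \<delta> \<theta> f"])
  then have l: "l \<in> L2 M" "AE x in M. l x = eff_score x"
    by (auto simp: is_efficient_score_iff)
  have "(\<integral>x. (l x)\<^sup>2 \<partial>M) = (\<integral>x. (eff_score x)\<^sup>2 \<partial>M)"
    using l eff_score_L2[THEN L2_measurable] L2_measurable[OF l(1)]
    by (intro integral_cong_AE) auto
  then show ?thesis
    by (simp add: efficient_information_def l_def eff_score_square_integral)
qed

text \<open>The score is \<open>eff_score\<close> plus the orthogonal \<open>score_proj\<close>, so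
  this inner product is the squared norm of \<open>eff_score\<close>. It supplies the normalisation
  of the influence function.\<close>

lemma eff_score_score_integral:
  "(\<integral>x. eff_score x * score \<theta> f x \<partial>M) = \<delta> / (\<theta> * (1 - \<theta> * \<delta>))"
proof -
  have "(\<integral>x. eff_score x * score \<theta> f x \<partial>M) = (\<integral>x. eff_score x * eff_score x + eff_score x * score_proj x \<partial>M)"
    by (simp add: score_proj_def algebra_simps)
  also have "\<dots> = (\<integral>x. (eff_score x)\<^sup>2 \<partial>M)"
    using L2_integrable_mult[OF eff_score_L2 eff_score_L2] L2_integrable_mult[OF eff_score_L2 score_proj_L2]
      eff_score_orth_closure[OF score_proj_closure] by (simp add: power2_eq_square)
  finally show ?thesis by (simp add: eff_score_square_integral)
qed

section \<open>Influence functions: none for \<delta> = 0, an efficient one for \<delta> > 0\<close>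

lemma not_differentiable:
  assumes "\<delta> = 0"
  shows "\<not> functional_differentiable \<delta> \<theta> f"
proof
  assume "functional_differentiable \<delta> \<theta> f"
  then obtain \<psi> where \<psi>: "\<psi> \<in> L2 M"
    and inf: "\<And>a h. h \<in> T \<Longrightarrow> a = (\<integral>x. \<psi> x * (a * score \<theta> f x + h x) \<partial>M)"
    unfolding functional_differentiable_def is_influence_function_def by blast
  obtain h where h: "h \<in> T" "AE x in M. h x = - score_proj x"
    by (rule neg_score_proj_nuisance)
  have "(\<integral>x. (eff_score x)\<^sup>2 \<partial>M) = 0"
    unfolding eff_score_square_integral using assms by simp
  then have "AE x in M. (eff_score x)\<^sup>2 = 0"
    using eff_score_L2 by (subst (asm) integral_nonneg_eq_0_iff_AE) (auto simp: L2_def)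
  \<comment> \<open>The direction a = 1 with this h has score \<open>eff_score\<close> = 0 almost
    everywhere, although \<theta> moves at unit rate along it.\<close>
  with h(2) have "AE x in M. \<psi> x * (1 * score \<theta> f x + h x) = 0"
    by eventually_elim (simp add: score_proj_def)
  moreover have "(\<lambda>x. \<psi> x * (1 * score \<theta> f x + h x)) \<in> borel_measurable M"
    using L2_measurable[OF \<psi>] L2_measurable[OF score_L2] L2_measurable[of h] h(1) nuisance_L2 by auto
  ultimately have "(\<integral>x. \<psi> x * (1 * score \<theta> f x + h x) \<partial>M) = 0"
    by (intro integral_eq_zero_AE)
  then show False using inf[OF h(1), of 1] by simp
qed

text \<open>All influence functions have the same inner products with the tangent set, so their
  differences are orthogonal to it, hence to its closed span. This yields uniqueness of the
  efficient one.\<close>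

lemma influence_orth:
  assumes "is_influence_function \<delta> \<theta> f \<psi>" "is_influence_function \<delta> \<theta> f \<phi>"
    and "v \<in> L2_closure M (lin_span (tangent_set \<delta> \<theta> f))"
  shows "(\<integral>x. (\<psi> x - \<phi> x) * v x \<partial>M) = 0"
proof -
  have L: "\<psi> \<in> L2 M" "\<phi> \<in> L2 M" using assms by (auto simp: is_influence_function_def)
  have "(\<integral>x. (\<psi> x - \<phi> x) * t x \<partial>M) = 0" if "t \<in> tangent_set \<delta> \<theta> f" for t
  proof -
    from that obtain \<alpha> \<beta> h where t: "t = (\<lambda>x. \<alpha> * score \<theta> f x + \<beta> * h x)" and h: "h \<in> T"
      unfolding tangent_set_def by blast
    have hL: "h \<in> L2 M" using h nuisance_L2 by auto
    \<comment> \<open>The defining identity gives h the coefficient 1 only. The cases a = 1, h = 0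
      and a = 0 are extracted separately, and linearity then covers every \<beta>.\<close>
    have val: "(\<integral>x. \<zeta> x * t x \<partial>M) = \<alpha>" if \<zeta>: "is_influence_function \<delta> \<theta> f \<zeta>" for \<zeta>
    proof -
      have \<zeta>L: "\<zeta> \<in> L2 M" and inf: "\<And>a h. h \<in> T \<Longrightarrow> a = (\<integral>x. \<zeta> x * (a * score \<theta> f x + h x) \<partial>M)"
        using \<zeta> unfolding is_influence_function_def by blast+
      have s: "(\<integral>x. \<zeta> x * score \<theta> f x \<partial>M) = 1" using inf[OF zero_nuisance, of 1] by simp
      have h0: "(\<integral>x. \<zeta> x * h x \<partial>M) = 0" using inf[OF h, of 0] by simp
      have "(\<integral>x. \<zeta> x * t x \<partial>M) = (\<integral>x. \<alpha> * (\<zeta> x * score \<theta> f x) + \<beta> * (\<zeta> x * h x) \<partial>M)"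
        by (simp add: t algebra_simps)
      also have "\<dots> = \<alpha>"
        using L2_integrable_mult[OF \<zeta>L score_L2] L2_integrable_mult[OF \<zeta>L hL] s h0 by simp
      finally show ?thesis .
    qed
    have tL: "t \<in> L2 M" using that tangent_L2 by auto
    have "(\<integral>x. (\<psi> x - \<phi> x) * t x \<partial>M) = (\<integral>x. \<psi> x * t x - \<phi> x * t x \<partial>M)"
      by (simp add: algebra_simps)
    also have "\<dots> = 0"
      using L2_integrable_mult[OF L(1) tL] L2_integrable_mult[OF L(2) tL] val assms(1,2) by simp
    finally show ?thesis .
  qed
  then show ?thesis
    using orthogonal_L2_closure[OF L2_diff[OF L] orthogonal_lin_span[OF L2_diff[OF L] tangent_L2] assms(3)]
    by blast
qed

text \<open>For \<delta> > 0 this is the efficient score divided by the efficient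
  information.\<close>

definition eff_influence :: "real \<Rightarrow> real" where
  "eff_influence x = \<theta> * (1 - \<theta> * \<delta>) / \<delta> * eff_score x"

text \<open>On [0,1] the complement of [0, 1 - \<delta>) is [1 - \<delta>, 1]; off [0,1] the two
  formulas differ.\<close>

lemma eff_influence_unit:
  assumes "\<delta> > 0" "x \<in> {0..1}"
  shows "eff_influence x = 1 / \<delta> * indicat_real {1 - \<delta>..1} x - \<theta>"
  using assms \<theta> \<theta>\<delta> by (auto simp: eff_influence_def eff_score_def indicator_def field_simps)

lemma eff_influence_L2: "eff_influence \<in> L2 M"
  using L2_lincomb[OF eff_score_L2 eff_score_L2, of "\<theta> * (1 - \<theta> * \<delta>) / \<delta>" 0]
  by (simp add: eff_influence_def[abs_def])

text \<open>Orthogonality removes h, and the factor in front of \<open>eff_score\<close> normalises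
  its inner product with the score to 1.\<close>

lemma is_influence_function_AE:
  assumes \<delta>: "\<delta> > 0" and \<psi>: "\<psi> \<in> L2 M" "AE x in M. \<psi> x = eff_influence x"
  shows "is_influence_function \<delta> \<theta> f \<psi>"
  unfolding is_influence_function_def
proof (intro conjI allI ballI \<psi>(1))
  fix a h assume h: "h \<in> T"
  then have hL: "h \<in> L2 M" using nuisance_L2 by auto
  define c where "c = \<theta> * (1 - \<theta> * \<delta>) / \<delta>"
  have "(\<integral>x. \<psi> x * (a * score \<theta> f x + h x) \<partial>M) =
      (\<integral>x. c * (a * (eff_score x * score \<theta> f x) + eff_score x * h x) \<partial>M)"
  proof (rule integral_cong_AE)
    show "AE x in M. \<psi> x * (a * score \<theta> f x + h x) =
        c * (a * (eff_score x * score \<theta> f x) + eff_score x * h x)"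
      using \<psi>(2) unfolding eff_influence_def c_def[symmetric] by eventually_elim (simp add: algebra_simps)
  qed (use \<psi>(1) hL score_L2 eff_score_L2 in \<open>auto dest!: L2_measurable\<close>)
  also have "\<dots> = c * (a * (\<delta> / (\<theta> * (1 - \<theta> * \<delta>))))"
    using L2_integrable_mult[OF eff_score_L2 score_L2] L2_integrable_mult[OF eff_score_L2 hL]
    by (simp add: eff_score_score_integral eff_score_orth_nuisance[OF h])
  also have "\<dots> = a" using \<theta> \<theta>\<delta> \<delta> by (simp add: c_def)
  finally show "a = (\<integral>x. \<psi> x * (a * score \<theta> f x + h x) \<partial>M)" by simp
qed

text \<open>With h = - \<open>score_proj\<close> almost everywhere, score + h is a tangent element
  representing \<open>eff_score\<close>; a scalar multiple of it is reached without a limit.\<close>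

lemma eff_influence_closure:
  assumes \<psi>: "\<psi> \<in> L2 M" "AE x in M. \<psi> x = eff_influence x"
  shows "\<psi> \<in> L2_closure M (lin_span (tangent_set \<delta> \<theta> f))"
proof -
  obtain h where h: "h \<in> T" "AE x in M. h x = - score_proj x"
    by (rule neg_score_proj_nuisance)
  define t where "t x = 1 * score \<theta> f x + 1 * h x" for x
  have "t \<in> tangent_set \<delta> \<theta> f"
    unfolding tangent_set_def t_def using h(1) by blast
  then have s: "(\<lambda>x. \<theta> * (1 - \<theta> * \<delta>) / \<delta> * t x) \<in> lin_span (tangent_set \<delta> \<theta> f)" (is "?s \<in> _")
    by (rule lin_span_scale)
  show ?thesis
  proof (rule L2_closureI[OF \<psi>(1) s])
    show "?s \<in> L2 M" using s lin_span_L2[OF tangent_L2] by blast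
    show "AE x in M. \<psi> x = ?s x"
      using \<psi>(2) h(2) by eventually_elim (simp add: t_def eff_influence_def score_proj_def)
  qed
qed

text \<open>For uniqueness, the difference of two influence functions is orthogonal to the closed
  tangent span, which contains both of them.\<close>

lemma is_efficient_influence_function_iff:
  assumes \<delta>: "\<delta> > 0"
  shows "is_efficient_influence_function \<delta> \<theta> f \<psi> \<longleftrightarrow>
    \<psi> \<in> L2 M \<and> (AE x in M. \<psi> x = eff_influence x)"
proof safe
  assume eff: "is_efficient_influence_function \<delta> \<theta> f \<psi>"
  then show L: "\<psi> \<in> L2 M"
    by (simp add: is_efficient_influence_function_def is_influence_function_def)
  have orth: "v \<in> L2_closure M (lin_span (tangent_set \<delta> \<theta> f)) \<Longrightarrow>
      (\<integral>x. (\<psi> x - eff_influence x) * v x \<partial>M) = 0" for v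
    using eff influence_orth[OF _ is_influence_function_AE[OF \<delta> eff_influence_L2]]
    by (simp add: is_efficient_influence_function_def)
  show "AE x in M. \<psi> x = eff_influence x"
  proof (rule L2_AE_eqI[OF L eff_influence_L2])
    show "(\<integral>x. (\<psi> x - eff_influence x) * \<psi> x \<partial>M) = 0"
      using eff by (intro orth) (simp add: is_efficient_influence_function_def)
    show "(\<integral>x. (\<psi> x - eff_influence x) * eff_influence x \<partial>M) = 0"
      by (intro orth eff_influence_closure eff_influence_L2) simp
  qed
next
  assume "\<psi> \<in> L2 M" "AE x in M. \<psi> x = eff_influence x"
  then show "is_efficient_influence_function \<delta> \<theta> f \<psi>"
    unfolding is_efficient_influence_function_def
    using is_influence_function_AE[OF \<delta>] eff_influence_closure by blast
qed

end

theorem theorem1: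
  fixes \<delta> \<theta> :: real and f :: "real \<Rightarrow> real"
  assumes "0 \<le> \<delta>" "\<delta> < 1" and "0 < \<theta>" "\<theta> < 1" and "f \<in> density_class \<delta>"
  shows
    "(\<forall>l. is_efficient_score \<delta> \<theta> f l \<longleftrightarrow>
        l \<in> L2 (mix_measure \<theta> f) \<and>
        (AE x in mix_measure \<theta> f.
           l x = 1 / \<theta> - 1 / (\<theta> * (1 - \<theta> * \<delta>)) * indicat_real {0..<1 - \<delta>} x)) \<and>
     efficient_information \<delta> \<theta> f = \<delta> / (\<theta> * (1 - \<theta> * \<delta>)) \<and>
     (\<delta> = 0 \<longrightarrow> efficient_information \<delta> \<theta> f = 0 \<and> \<not> functional_differentiable \<delta> \<theta> f) \<and>
     (\<delta> > 0 \<longrightarrow>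
        functional_differentiable \<delta> \<theta> f \<and>
        (\<forall>\<psi>. is_efficient_influence_function \<delta> \<theta> f \<psi> \<longleftrightarrow>
          \<psi> \<in> L2 (mix_measure \<theta> f) \<and>
          (AE x in mix_measure \<theta> f.
             \<psi> x = 1 / \<delta> * indicat_real {1 - \<delta>..1} x - \<theta>)))"
proof -
  interpret mixture_model \<delta> \<theta> f
    using assms by unfold_locales
  have "functional_differentiable \<delta> \<theta> f" if "\<delta> > 0"
    using is_influence_function_AE[OF that eff_influence_L2]
    by (auto simp: functional_differentiable_def)
  moreover have "(AE x in M. \<psi> x = eff_influence x) \<longleftrightarrow>
      (AE x in M. \<psi> x = 1 / \<delta> * indicat_real {1 - \<delta>..1} x - \<theta>)" if "\<delta> > 0" for \<psi>
    using eff_influence_unit[OF that] space_M by (intro AE_cong) auto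
  moreover have "efficient_information \<delta> \<theta> f = 0" if "\<delta> = 0"
    unfolding efficient_information_eq using that by simp
  ultimately show ?thesis
    using is_efficient_score_iff[unfolded eff_score_def] efficient_information_eq
      not_differentiable is_efficient_influence_function_iff
    by presburger
qed

end
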